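(* Let $A\in\mathbb{R}^{m\times n}$, $b\in\mathbb{R}^m$, $L\in\mathbb{R}^{p\times n}$, $\lambda>0$. Let $V_0\in\mathbb{R}^{n\times\ell}$ have orthonormal columns and let $W_0\in\mathbb{R}^{n\times \ell}$ satisfy $\operatorname{range}(W_0)=\operatorname{range}(V_0)$. Let $x_k^{\mathrm{GKS}}=V_k y_k^{\mathrm{GKS}}$ be the approximate solution obtained by running $k$ iterations of the GKS method started from $V_0$, and let $x_k^{\mathrm{sGKS}_0}=W_k y_k^{\mathrm{sGKS}_0}$ be the approximate solution obtained by running $k$ iterations of the $\mathrm{sGKS}_0$ method (the sGKS method in which the projected problem is solved without sketching) started from $W_0$, both with the same $A,b,L,\lambda$ (both methods are defined in the context). Then $$x_k^{\mathrm{GKS}}=x_k^{\mathrm{sGKS}_0}.$$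
   Context: All computations are in exact arithmetic, and $\|\cdot\|_2$ is the Euclidean norm. Write $d_k=\ell+k$. Both methods approximate the minimizer over $x\in\mathbb{R}^n$ of the Tikhonov functional $\|Ax-b\|_2^2+\lambda\|Lx\|_2^2$ with fixed $\lambda>0$. GKS method (generalized Krylov subspace method). Given $V_0\in\mathbb{R}^{n\times \ell}$ with $V_0^\top V_0=I_\ell$, for $k=0,1,2,\dots$: (i) $y_k^{\mathrm{GKS}}=\arg\min_{y\in\mathbb{R}^{d_k}}\{\|AV_ky-b\|_2^2+\lambda\|LV_ky\|_2^2\}$, and $x_k^{\mathrm{GKS}}=V_ky_k^{\mathrm{GKS}}$; (ii) the gradient is $r_{k+1}=A^\top(AV_ky_k^{\mathrm{GKS}}-b)+\lambda L^\top (LV_ky_k^{\mathrm{GKS}})$; (iii) $\widetilde v=(I-V_kV_k^\top)r_{k+1}$ (the projection $I-V_kV_k^\top$ may be applied a second time, which changes nothing in exact arithmetic), $v_{\mathrm{new}}=\widetilde v/\|\widetilde v\|_2$, and $V_{k+1}=[V_k,\,v_{\mathrm{new}}]\in\mathbb{R}^{n\times d_{k+1}}$. $\mathrm{sGKS}_0$ method (sGKS with unsketched projected problem). Given $W_0\in\mathbb{R}^{n\times\ell}$, for $k=0,1,2,\dots$: (i) $y_k^{\mathrm{sGKS}_0}=\arg\min_{y\in\mathbb{R}^{d_k}}\{\|AW_ky-b\|_2^2+\lambda\|LW_ky\|_2^2\}$, and $x_k^{\mathrm{sGKS}_0}=W_ky_k^{\mathrm{sGKS}_0}$; (ii) $r_{k+1}=A^\top(AW_ky_k^{\mathrm{sGKS}_0}-b)+\lambda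 L^\top (LW_ky_k^{\mathrm{sGKS}_0})$; (iii) $W_{k+1}=[W_k,\,r_{k+1}]\in\mathbb{R}^{n\times d_{k+1}}$ (no orthogonalization or normalization). Conventions: each $\arg\min$ denotes the unique minimizer of the corresponding problem (uniqueness is assumed at every step performed), and "running $k$ iterations" means that the steps are well defined up to index $k$, i.e. the vector $\widetilde v$ normalized in step (iii) of GKS is nonzero at every expansion used to build $V_k$; no stopping criterion is triggered before index $k$. *)

theory Defs
  imports "Jordan_Normal_Form.Matrix" "HOL-Analysis.L2_Norm"
begin

definition norm2 :: "real vec \<Rightarrow> real" where
  "norm2 v = L2_set (vec_index v) {..<dim_vec v}"

definition mat_range :: "real mat \<Rightarrow> real vec set" where
  "mat_range M = (\<lambda>y. M *\<^sub>v y) ` carrier_vec (dim_col M)"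

definition append_col :: "real mat \<Rightarrow> real vec \<Rightarrow> real mat" where
  "append_col M v = mat_of_cols (dim_row M) (cols M @ [v])"

definition tikhonov :: "real mat \<Rightarrow> real vec \<Rightarrow> real mat \<Rightarrow> real \<Rightarrow> real vec \<Rightarrow> real" where
  "tikhonov A b L lam x = (norm2 (A *\<^sub>v x - b))\<^sup>2 + lam * (norm2 (L *\<^sub>v x))\<^sup>2"

text \<open>This is half of the gradient of the Tikhonov functional; the factor 2 is dropped, as is
  customary for these methods.\<close>

definition tikhonov_grad :: "real mat \<Rightarrow> real vec \<Rightarrow> real mat \<Rightarrow> real \<Rightarrow> real vec \<Rightarrow> real vec" where
  "tikhonov_grad A b L lam x =
     transpose_mat A *\<^sub>v (A *\<^sub>v x - b) + lam \<cdot>\<^sub>v (transpose_mat L *\<^sub>v (L *\<^sub>v x))"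

text \<open>The projected problem minimizes the functional over \<open>M y\<close>. The value of \<open>arg_min\<close> is only
  meaningful when \<open>unique_proj_min\<close> holds.\<close>

definition unique_proj_min :: "real mat \<Rightarrow> real vec \<Rightarrow> real mat \<Rightarrow> real \<Rightarrow> real mat \<Rightarrow> bool" where
  "unique_proj_min A b L lam M \<longleftrightarrow>
     (\<exists>!y. is_arg_min (\<lambda>y. tikhonov A b L lam (M *\<^sub>v y)) (\<lambda>y. y \<in> carrier_vec (dim_col M)) y)"

definition proj_min :: "real mat \<Rightarrow> real vec \<Rightarrow> real mat \<Rightarrow> real \<Rightarrow> real mat \<Rightarrow> real vec" where
  "proj_min A b L lam M =
     arg_min (\<lambda>y. tikhonov A b L lam (M *\<^sub>v y)) (\<lambda>y. y \<in> carrier_vec (dim_col M))"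

definition proj_residual :: "real mat \<Rightarrow> real vec \<Rightarrow> real mat \<Rightarrow> real \<Rightarrow> real mat \<Rightarrow> real vec" where
  "proj_residual A b L lam M = tikhonov_grad A b L lam (M *\<^sub>v proj_min A b L lam M)"

definition gks_direction :: "real mat \<Rightarrow> real vec \<Rightarrow> real mat \<Rightarrow> real \<Rightarrow> real mat \<Rightarrow> real vec" where
  "gks_direction A b L lam V =
     (1\<^sub>m (dim_row V) - V * transpose_mat V) *\<^sub>v proj_residual A b L lam V"

primrec gks_basis :: "real mat \<Rightarrow> real vec \<Rightarrow> real mat \<Rightarrow> real \<Rightarrow> real mat \<Rightarrow> nat \<Rightarrow> real mat" where
  "gks_basis A b L lam V0 0 = V0"
| "gks_basis A b L lam V0 (Suc k) =
     (let V = gks_basis A b L lam V0 k; v = gks_direction A b L lam V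
      in append_col V ((1 / norm2 v) \<cdot>\<^sub>v v))"

primrec sgks0_basis :: "real mat \<Rightarrow> real vec \<Rightarrow> real mat \<Rightarrow> real \<Rightarrow> real mat \<Rightarrow> nat \<Rightarrow> real mat" where
  "sgks0_basis A b L lam W0 0 = W0"
| "sgks0_basis A b L lam W0 (Suc k) =
     (let W = sgks0_basis A b L lam W0 k in append_col W (proj_residual A b L lam W))"

definition gks_solution :: "real mat \<Rightarrow> real vec \<Rightarrow> real mat \<Rightarrow> real \<Rightarrow> real mat \<Rightarrow> nat \<Rightarrow> real vec" where
  "gks_solution A b L lam V0 k =
     (let V = gks_basis A b L lam V0 k in V *\<^sub>v proj_min A b L lam V)"

definition sgks0_solution :: "real mat \<Rightarrow> real vec \<Rightarrow> real mat \<Rightarrow> real \<Rightarrow> real mat \<Rightarrow> nat \<Rightarrow> real vec" where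
  "sgks0_solution A b L lam W0 k =
     (let W = sgks0_basis A b L lam W0 k in W *\<^sub>v proj_min A b L lam W)"

text \<open>Well-definedness up to index \<open>k\<close>: the projected problems \<open>0, \<dots>, k\<close> are solved, but only the
  expansions of the bases \<open>0, \<dots>, k - 1\<close> are carried out.\<close>

definition gks_well_defined :: "real mat \<Rightarrow> real vec \<Rightarrow> real mat \<Rightarrow> real \<Rightarrow> real mat \<Rightarrow> nat \<Rightarrow> bool" where
  "gks_well_defined A b L lam V0 k \<longleftrightarrow>
     (\<forall>j\<le>k. unique_proj_min A b L lam (gks_basis A b L lam V0 j)) \<and>
     (\<forall>j<k. gks_direction A b L lam (gks_basis A b L lam V0 j) \<noteq> 0\<^sub>v (dim_row V0))"

definition sgks0_well_defined :: "real mat \<Rightarrow> real vec \<Rightarrow> real mat \<Rightarrow> real \<Rightarrow> real mat \<Rightarrow> nat \<Rightarrow> bool" where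
  "sgks0_well_defined A b L lam W0 k \<longleftrightarrow>
     (\<forall>j\<le>k. unique_proj_min A b L lam (sgks0_basis A b L lam W0 j))"

lemma append_col_carrier:
  assumes "M \<in> carrier_mat n d"
  shows "append_col M v \<in> carrier_mat n (Suc d)"
proof -
  have "length (cols M @ [v]) = Suc d" and "dim_row M = n"
    using assms by simp_all
  then show ?thesis
    unfolding append_col_def by (metis mat_of_cols_carrier(1))
qed

lemma gks_basis_carrier:
  assumes "V0 \<in> carrier_mat n l"
  shows "gks_basis A b L lam V0 k \<in> carrier_mat n (l + k)"
proof (induction k)
  case 0
  show ?case using assms by simp
next
  case (Suc k)
  show ?case
    unfolding gks_basis.simps Let_def add_Suc_right by (rule append_col_carrier[OF Suc])
qed

lemma sgks0_basis_carrier: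
  assumes "W0 \<in> carrier_mat n l"
  shows "sgks0_basis A b L lam W0 k \<in> carrier_mat n (l + k)"
proof (induction k)
  case 0
  show ?case using assms by simp
next
  case (Suc k)
  show ?case
    unfolding sgks0_basis.simps Let_def add_Suc_right by (rule append_col_carrier[OF Suc])
qed

end

theory Submission
  imports Defs
begin

text \<open>The solution of a projected problem depends only on the range of the basis, by uniqueness of
  the minimizer. Inductively, both methods expand the same range by the same residual: subtracting
  \<open>V V\<^sup>T r\<close> from \<open>r\<close>, an element of the range, and rescaling do not change the span.\<close>

lemma norm2_eq_0_iff: "norm2 v = 0 \<longleftrightarrow> v = 0\<^sub>v (dim_vec v)"
  unfolding norm2_def by (auto simp: L2_set_eq_0_iff vec_eq_iff)

lemma append_col_mult_vec:
  assumes M: "M \<in> carrier_mat n d" and v: "v \<in> carrier_vec n" and y: "y \<in> carrier_vec (Suc d)"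
  shows "append_col M v *\<^sub>v y = M *\<^sub>v vec d (vec_index y) + y $ d \<cdot>\<^sub>v v"
proof (rule eq_vecI)
  fix i
  assume "i < dim_vec (M *\<^sub>v vec d (vec_index y) + y $ d \<cdot>\<^sub>v v)"
  then have i: "i < n" using v by simp
  have entry: "append_col M v $$ (i, j) = (if j < d then M $$ (i, j) else v $ i)"
    if "j < Suc d" for j
    using that i M v unfolding append_col_def by (auto simp: mat_of_cols_index nth_append)
  have "(append_col M v *\<^sub>v y) $ i = (\<Sum>j<Suc d. append_col M v $$ (i, j) * y $ j)"
    using append_col_carrier[OF M, of v] i y by (auto simp: scalar_prod_def atLeast0LessThan)
  also have "\<dots> = (\<Sum>j<d. M $$ (i, j) * y $ j) + v $ i * y $ d"
    by (simp add: entry)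
  also have "\<dots> = (M *\<^sub>v vec d (vec_index y) + y $ d \<cdot>\<^sub>v v) $ i"
    using M v i by (simp add: scalar_prod_def atLeast0LessThan)
  finally show "(append_col M v *\<^sub>v y) $ i = (M *\<^sub>v vec d (vec_index y) + y $ d \<cdot>\<^sub>v v) $ i" .
next
  show "dim_vec (append_col M v *\<^sub>v y) = dim_vec (M *\<^sub>v vec d (vec_index y) + y $ d \<cdot>\<^sub>v v)"
    using append_col_carrier[OF M, of v] v by simp
qed

text \<open>The last coordinate of a coefficient vector becomes the free scalar \<open>c\<close>,
  the first \<open>d\<close> coordinates produce \<open>u\<close>. The right-hand side mentions
  \<open>M\<close> only through \<open>mat_range M\<close>, so equal ranges expanded by the same
  vector stay equal.\<close>

lemma mat_range_append_col:
  assumes M: "M \<in> carrier_mat n d" and v: "v \<in> carrier_vec n"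
  shows "mat_range (append_col M v) = {u + c \<cdot>\<^sub>v v | u c. u \<in> mat_range M}"
proof (intro subset_antisym subsetI)
  fix x
  assume "x \<in> mat_range (append_col M v)"
  then obtain y where y: "y \<in> carrier_vec (Suc d)" "x = append_col M v *\<^sub>v y"
    using append_col_carrier[OF M, of v] by (auto simp: mat_range_def)
  have "M *\<^sub>v vec d (vec_index y) \<in> mat_range M"
    using M by (auto simp: mat_range_def)
  then show "x \<in> {u + c \<cdot>\<^sub>v v | u c. u \<in> mat_range M}"
    using append_col_mult_vec[OF M v y(1)] y(2) by blast
next
  fix x
  assume "x \<in> {u + c \<cdot>\<^sub>v v | u c. u \<in> mat_range M}"
  then obtain z c where z: "z \<in> carrier_vec d" and x: "x = M *\<^sub>v z + c \<cdot>\<^sub>v v"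
    using M by (auto simp: mat_range_def)
  define y where "y = vec (Suc d) (\<lambda>j. if j < d then z $ j else c)"
  have y: "y \<in> carrier_vec (Suc d)" "vec d (vec_index y) = z" "y $ d = c"
    using z by (auto simp: y_def)
  have "x = append_col M v *\<^sub>v y"
    using append_col_mult_vec[OF M v y(1)] x y by simp
  then show "x \<in> mat_range (append_col M v)"
    using y(1) append_col_carrier[OF M, of v] by (auto simp: mat_range_def)
qed

lemma mat_range_add_mult_vec:
  assumes M: "M \<in> carrier_mat n d" and u: "u \<in> mat_range M" and z: "z \<in> carrier_vec d"
  shows "u + c \<cdot>\<^sub>v (M *\<^sub>v z) \<in> mat_range M"
proof -
  obtain y where y: "y \<in> carrier_vec d" "u = M *\<^sub>v y"
    using u M by (auto simp: mat_range_def)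
  have "u + c \<cdot>\<^sub>v (M *\<^sub>v z) = M *\<^sub>v (y + c \<cdot>\<^sub>v z)"
    using M y z by (simp add: mult_add_distrib_mat_vec mult_mat_vec)
  then show ?thesis
    using M y z by (auto simp: mat_range_def)
qed

text \<open>A column operation: \<open>M *\<^sub>v z\<close> already lies in the range and can be
  absorbed there, and the scaling by \<open>a\<close> can be undone by division.\<close>

lemma mat_range_append_col_reduce:
  assumes M: "M \<in> carrier_mat n d" and r: "r \<in> carrier_vec n" and z: "z \<in> carrier_vec d"
    and a: "a \<noteq> 0"
  shows "mat_range (append_col M (a \<cdot>\<^sub>v (r - M *\<^sub>v z))) = mat_range (append_col M r)"
proof -
  let ?v = "a \<cdot>\<^sub>v (r - M *\<^sub>v z)"
  have v: "?v \<in> carrier_vec n"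
    using M r z by simp
  have dim: "dim_vec u = n" if "u \<in> mat_range M" for u
    using that M by (auto simp: mat_range_def)
  \<comment> \<open>Each inclusion trades one new column for the other, with weight
    \<open>c * a\<close> on \<open>r\<close> here and \<open>c / a\<close> on \<open>?v\<close>
    below; the leftover multiple of \<open>M *\<^sub>v z\<close> is merged into \<open>u\<close> by
    \<open>mat_range_add_mult_vec\<close>.\<close>
  have "u + c \<cdot>\<^sub>v ?v = (u + (- (c * a)) \<cdot>\<^sub>v (M *\<^sub>v z)) + (c * a) \<cdot>\<^sub>v r"
    if "u \<in> mat_range M" for u c
    using M r z dim[OF that] by (intro eq_vecI) (auto simp: algebra_simps)
  moreover have "u + c \<cdot>\<^sub>v r = (u + c \<cdot>\<^sub>v (M *\<^sub>v z)) + (c / a) \<cdot>\<^sub>v ?v"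
    if "u \<in> mat_range M" for u c
    using M r z a dim[OF that] by (intro eq_vecI) (auto simp: algebra_simps)
  ultimately show ?thesis
    unfolding mat_range_append_col[OF M v] mat_range_append_col[OF M r]
    using mat_range_add_mult_vec[OF M _ z] by blast
qed

text \<open>\<open>arg_min\<close> is a Hilbert choice, so the existence half of
  \<open>unique_proj_min\<close> makes the chosen vector a minimizer.\<close>

lemma is_arg_min_proj_min:
  assumes "unique_proj_min A b L lam M"
  shows "is_arg_min (\<lambda>y. tikhonov A b L lam (M *\<^sub>v y)) (\<lambda>y. y \<in> carrier_vec (dim_col M))
    (proj_min A b L lam M)"
  using assms unfolding unique_proj_min_def proj_min_def arg_min_def by (metis someI_ex)

text \<open>Both problems minimize the same functional over the same set of vectors
  \<open>x\<close>; only the coordinates differ. The solution for \<open>V\<close> is rewritten in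
  coordinates \<open>z\<close> for \<open>W\<close>, and uniqueness for \<open>W\<close> identifies
  \<open>z\<close>.\<close>

lemma proj_solution_cong:
  assumes V: "unique_proj_min A b L lam V" and W: "unique_proj_min A b L lam W"
    and range: "mat_range V = mat_range W"
  shows "V *\<^sub>v proj_min A b L lam V = W *\<^sub>v proj_min A b L lam W"
proof -
  let ?f = "tikhonov A b L lam" and ?y = "proj_min A b L lam V"
  have min: "?f (V *\<^sub>v ?y) \<le> ?f x" if "x \<in> mat_range V" for x
    using is_arg_min_proj_min[OF V] that by (auto simp: is_arg_min_linorder mat_range_def)
  have "V *\<^sub>v ?y \<in> mat_range W"
    using is_arg_min_proj_min[OF V] unfolding range[symmetric]
    by (auto simp: is_arg_min_linorder mat_range_def)
  then obtain z where z: "z \<in> carrier_vec (dim_col W)" "V *\<^sub>v ?y = W *\<^sub>v z"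
    by (auto simp: mat_range_def)
  \<comment> \<open>Every competitor \<open>W *\<^sub>v y\<close> lies in the common range, where
    \<open>min\<close> applies.\<close>
  have "is_arg_min (\<lambda>y. ?f (W *\<^sub>v y)) (\<lambda>y. y \<in> carrier_vec (dim_col W)) z"
    using z min unfolding range by (auto simp: is_arg_min_linorder mat_range_def)
  then have "z = proj_min A b L lam W"
    using W is_arg_min_proj_min[OF W] unfolding unique_proj_min_def by blast
  then show ?thesis using z(2) by simp
qed

lemma proj_residual_carrier:
  assumes "A \<in> carrier_mat m n" and "L \<in> carrier_mat p n"
  shows "proj_residual A b L lam M \<in> carrier_vec n"
  using assms unfolding proj_residual_def tikhonov_grad_def by (intro carrier_vecI) simp

text \<open>Reassociating the product exhibits the removed component as an element of the range of
  \<open>V\<close>, the shape \<open>r - M *\<^sub>v z\<close> of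
  \<open>mat_range_append_col_reduce\<close> with \<open>z\<close> the vector
  \<open>transpose_mat V *\<^sub>v r\<close>.\<close>

lemma gks_direction_eq:
  assumes V: "V \<in> carrier_mat n d" and r: "proj_residual A b L lam V \<in> carrier_vec n"
  shows "gks_direction A b L lam V =
    proj_residual A b L lam V - V *\<^sub>v (transpose_mat V *\<^sub>v proj_residual A b L lam V)"
proof -
  have "V * transpose_mat V \<in> carrier_mat n n"
    using V by simp
  then show ?thesis
    using V r unfolding gks_direction_def
    by (simp add: minus_mult_distrib_mat_vec[of _ n n] assoc_mult_mat_vec[of _ n d _ n])
qed

lemma mat_range_gks_step:
  assumes V: "V \<in> carrier_mat n d" and r: "proj_residual A b L lam V \<in> carrier_vec n"
    and v: "gks_direction A b L lam V \<noteq> 0\<^sub>v n"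
  shows "mat_range (append_col V
      ((1 / norm2 (gks_direction A b L lam V)) \<cdot>\<^sub>v gks_direction A b L lam V)) =
    mat_range (append_col V (proj_residual A b L lam V))"
proof -
  have "dim_vec (gks_direction A b L lam V) = n"
    using V r by (simp add: gks_direction_eq[OF V r])
  \<comment> \<open>This is where the absence of breakdown enters: as \<open>1 / 0 = 0\<close>, a
    vanishing direction would only append a zero column.\<close>
  then have "1 / norm2 (gks_direction A b L lam V) \<noteq> 0"
    using v by (simp add: norm2_eq_0_iff)
  moreover have "transpose_mat V *\<^sub>v proj_residual A b L lam V \<in> carrier_vec d"
    using V r by simp
  ultimately show ?thesis
    unfolding gks_direction_eq[OF V r] using mat_range_append_col_reduce[OF V r] by blast
qed

lemma mat_range_gks_basis:
  assumes A: "A \<in> carrier_mat m n" and L: "L \<in> carrier_mat p n"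
    and V0: "V0 \<in> carrier_mat n l" and W0: "W0 \<in> carrier_mat n l"
    and range0: "mat_range W0 = mat_range V0"
    and "gks_well_defined A b L lam V0 k" and "sgks0_well_defined A b L lam W0 k"
  shows "mat_range (gks_basis A b L lam V0 k) = mat_range (sgks0_basis A b L lam W0 k)"
  using assms(6,7)
proof (induction k)
  case 0
  then show ?case using range0 by simp
next
  case (Suc k)
  define V where "V = gks_basis A b L lam V0 k"
  define W where "W = sgks0_basis A b L lam W0 k"
  have V: "V \<in> carrier_mat n (l + k)" and W: "W \<in> carrier_mat n (l + k)"
    unfolding V_def W_def by (rule gks_basis_carrier[OF V0], rule sgks0_basis_carrier[OF W0])
  have IH: "mat_range V = mat_range W"
    using Suc unfolding V_def W_def gks_well_defined_def sgks0_well_defined_def by simp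
  \<comment> \<open>Well-definedness up to \<open>Suc k\<close> covers the projected problems at
    \<open>k\<close> and, since \<open>k < Suc k\<close>, the expansion of the basis
    \<open>k\<close>.\<close>
  have "unique_proj_min A b L lam V" "unique_proj_min A b L lam W"
    and v: "gks_direction A b L lam V \<noteq> 0\<^sub>v n"
    using Suc.prems V0 unfolding V_def W_def gks_well_defined_def sgks0_well_defined_def by auto
  \<comment> \<open>The residual sees the basis only through the projected solution, on which the
    two methods agree.\<close>
  then have res: "proj_residual A b L lam V = proj_residual A b L lam W"
    unfolding proj_residual_def using proj_solution_cong[OF _ _ IH] by metis
  have r: "proj_residual A b L lam M \<in> carrier_vec n" for M
    by (rule proj_residual_carrier[OF A L])
  \<comment> \<open>First both bases are expanded by the raw residual;
    \<open>mat_range_gks_step\<close> then replaces it on the GKS side by the normalized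
    direction.\<close>
  have "mat_range (append_col V (proj_residual A b L lam V)) =
      mat_range (append_col W (proj_residual A b L lam W))"
    unfolding mat_range_append_col[OF V r] mat_range_append_col[OF W r] IH res ..
  then show ?case
    using mat_range_gks_step[OF V r v] by (simp add: V_def W_def Let_def)
qed

theorem proposition1:
  fixes A L V0 W0 :: "real mat" and b :: "real vec" and lam :: real
    and m n p l k :: nat
  assumes "A \<in> carrier_mat m n"
    and "b \<in> carrier_vec m"
    and "L \<in> carrier_mat p n"
    and "lam > 0"
    and "V0 \<in> carrier_mat n l"
    and "transpose_mat V0 * V0 = 1\<^sub>m l"
    and "W0 \<in> carrier_mat n l"
    and "mat_range W0 = mat_range V0"
    and "gks_well_defined A b L lam V0 k"
    and "sgks0_well_defined A b L lam W0 k"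
  shows "gks_solution A b L lam V0 k = sgks0_solution A b L lam W0 k"
proof -
  \<comment> \<open>The projected problems are assumed uniquely solvable at the final index
    \<open>k\<close> as well, so equality of the ranges there suffices.\<close>
  have "unique_proj_min A b L lam (gks_basis A b L lam V0 k)"
    and "unique_proj_min A b L lam (sgks0_basis A b L lam W0 k)"
    using assms(9,10) unfolding gks_well_defined_def sgks0_well_defined_def by simp_all
  then show ?thesis
    unfolding gks_solution_def sgks0_solution_def Let_def
    using mat_range_gks_basis[OF assms(1,3,5,7-10)] by (rule proj_solution_cong)
qed

end
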